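(* For each $n\in\mathbb N$ let $u_n,p_n$ be smooth on a time interval (times $\mathbb T^3$), with $\operatorname{div}u_n=0$ and with the spatial mean of $u_n$ fixed in time, let $B_n(t,x)\in\mathbb S^3$ be smooth, and let $P_n$ and $\mathcal S_n=\mathcal S[u_n,B_n]$ be the associated pressure-free residual work and conformation residual. Let $E_n$ be time windows (measurable subsets of the respective time intervals) with $|E_n\times\mathbb T^3|\le M$ for a constant $M>0$, and suppose $$\|B_n\|_{L^\infty(E_n\times\mathbb T^3)}\le\varepsilon_n\to0\quad(0<\varepsilon_n\le1),\qquad \int_{E_n}[P_n(t)]_+\,dt\ge W_0>0,$$ with $W_0$ independent of $n$. If the residual-matching Reynolds states associated with $(u_n,p_n,B_n)$ are energy--entropy admissible, then $$\|\mathcal S_n\|_{L^2(E_n\times\mathbb T^3)}\ge\frac{2W_0}{\alpha e\,\varepsilon_nM^{1/2}}\to\infty.$$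
   Context: $\mathbb T^3$ is the flat periodic three-torus (Fourier modes $k\in\mathbb Z^3$); $\mathbb S^3$ is the space of real symmetric $3\times3$ matrices; $I$ is the identity; $M:N=\operatorname{tr}(MN^T)$ is the Frobenius product, and pointwise matrix norms are Frobenius norms. $(\nabla u)_{ij}=\partial_ju_i$, $D(u)=\frac12(\nabla u+(\nabla u)^T)$, divergence of matrix fields acts row-wise. $[x]_+=\max(x,0)$. $\nu,\alpha,\lambda>0$ are fixed parameters (independent of $n$); $e$ in the bound is Euler's number. For a velocity field $u$ and a scalar pressure $p$, smooth on a time interval (times $\mathbb T^3$), with $\operatorname{div}u=0$ and with the spatial mean of $u$ fixed in time, and for smooth $B(t,x)\in\mathbb S^3$, with $A=e^B$: $$\mathcal S[u,B]=\partial_tA+u\cdot\nabla A-\nabla u\,A-A(\nabla u)^T+\lambda^{-1}(A-I),$$ $$\mathcal N[u,B]=\partial_tu+\operatorname{div}(u\otimes u)-\nu\Delta u-\alpha\operatorname{div}(A-I),$$ the latter having zero spatial mean. Anti-divergence $\mathcal A$: for a smooth zero-mean vector field $m$, let $\phi$ be the unique zero-mean solution of $\Delta\phi+\frac13\nabla\operatorname{div}\phi=m$ and $(\mathcal Am)_{ij}=\partial_i\phi_j+\partial_j\phi_i-\frac23\delta_{ij}\operatorname{div}\phi$; then $\operatorname{div}(\mathcal Am)=m$. Put $R_{\mathcal N}=\mathcal A\,\mathcal N[u,B]$ and define the pressure-free residual work $P(t)=\int_{\mathbb T^3}-R_{\mathcal N}(t):D(u(t))\,dx$ ($P_n$ is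 this quantity for $(u_n,p_n,B_n)$). The residual-matching Reynolds state associated with $(u,p,B)$ has conformation defect $\mathcal S[u,B]$ and momentum defect $R_{\mathcal N}$ modulo the pressure tensor $pI$; it is energy--entropy admissible if, for a.e. $t$, $\int_{\mathbb T^3}\big[-R_{\mathcal N}:D(u)+\frac{\alpha}{2}(I-A^{-1}):\mathcal S[u,B]\big]dx\le0$. *)

theory Defs
  imports "HOL-Probability.Probability"
begin

section \<open>Smooth fields on the periodic three-torus\<close>

text \<open>
  The torus is \<open>(\<real> / 2\<pi>\<int>)\<^sup>3\<close>, so that the Fourier modes are \<open>exp (i k \<bullet> x)\<close> with \<open>k \<in> \<int>\<^sup>3\<close>.
  Fields on the torus are \<open>2\<pi>\<close>-periodic functions on \<^typ>\<open>real^3\<close>, and integrals over the torus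
  are integrals over the closed period cell (opposite faces overlap in a null set only).
\<close>

definition torus_cell :: "(real^3) set" where
  "torus_cell = cbox 0 (\<chi> i. 2 * pi)"

definition periodic :: "(real^3 \<Rightarrow> 'b) \<Rightarrow> bool" where
  "periodic f \<longleftrightarrow> (\<forall>x i. f (x + (2 * pi) *\<^sub>R axis i 1) = f x)"

text \<open>
  The derivative is taken within \<open>S\<close>, so that for \<open>S = J \<times> UNIV\<close> it is one-sided in time at an
  endpoint belonging to the interval \<open>J\<close>.  It is unique there as soon as \<open>J\<close> has interior points.
  In finite dimension, continuity of all \<open>x \<mapsto> f' x v\<close> is continuity of \<open>f'\<close>.
\<close>

primrec Ck_on :: "nat \<Rightarrow> ('a::euclidean_space \<Rightarrow> 'b::real_normed_vector) \<Rightarrow> 'a set \<Rightarrow> bool" where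
  "Ck_on 0 f S \<longleftrightarrow> continuous_on S f"
| "Ck_on (Suc k) f S \<longleftrightarrow>
     (\<exists>f'. (\<forall>x\<in>S. (f has_derivative f' x) (at x within S)) \<and> (\<forall>v. Ck_on k (\<lambda>x. f' x v) S))"

definition smooth_on :: "('a::euclidean_space \<Rightarrow> 'b::real_normed_vector) \<Rightarrow> 'a set \<Rightarrow> bool" where
  "smooth_on f S \<longleftrightarrow> (\<forall>k. Ck_on k f S)"

definition smooth_field :: "real set \<Rightarrow> (real \<Rightarrow> real^3 \<Rightarrow> 'b::real_normed_vector) \<Rightarrow> bool" where
  "smooth_field J f \<longleftrightarrow>
     smooth_on (\<lambda>(t, x). f t x) (J \<times> UNIV) \<and> (\<forall>t\<in>J. periodic (f t))"

definition spatial_mean :: "(real^3 \<Rightarrow> 'b::{banach, second_countable_topology}) \<Rightarrow> 'b" where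
  "spatial_mean f = (1 / (2 * pi) ^ 3) *\<^sub>R (LINT x:torus_cell|lebesgue. f x)"


section \<open>Differential operators\<close>

definition time_deriv ::
  "real set \<Rightarrow> (real \<Rightarrow> real^3 \<Rightarrow> 'b::real_normed_vector) \<Rightarrow> real \<Rightarrow> real^3 \<Rightarrow> 'b" where
  "time_deriv J f t x = vector_derivative (\<lambda>s. f s x) (at t within J)"

definition partial :: "3 \<Rightarrow> (real^3 \<Rightarrow> 'b::real_normed_vector) \<Rightarrow> real^3 \<Rightarrow> 'b" where
  "partial j f x = vector_derivative (\<lambda>h. f (x + h *\<^sub>R axis j 1)) (at 0)"

definition sgrad :: "(real^3 \<Rightarrow> real) \<Rightarrow> real^3 \<Rightarrow> real^3" where
  "sgrad f x = (\<chi> i. partial i f x)"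

definition vgrad :: "(real^3 \<Rightarrow> real^3) \<Rightarrow> real^3 \<Rightarrow> real^3^3" where
  "vgrad v x = (\<chi> i j. partial j (\<lambda>y. v y $ i) x)"

definition sym_grad :: "(real^3 \<Rightarrow> real^3) \<Rightarrow> real^3 \<Rightarrow> real^3^3" where
  "sym_grad v x = (1 / 2) *\<^sub>R (vgrad v x + transpose (vgrad v x))"

definition vdiv :: "(real^3 \<Rightarrow> real^3) \<Rightarrow> real^3 \<Rightarrow> real" where
  "vdiv v x = (\<Sum>i\<in>UNIV. partial i (\<lambda>y. v y $ i) x)"

definition mdiv :: "(real^3 \<Rightarrow> real^3^3) \<Rightarrow> real^3 \<Rightarrow> real^3" where
  "mdiv M x = (\<chi> i. \<Sum>j\<in>UNIV. partial j (\<lambda>y. M y $ i $ j) x)"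

definition vlaplacian :: "(real^3 \<Rightarrow> real^3) \<Rightarrow> real^3 \<Rightarrow> real^3" where
  "vlaplacian v x = (\<Sum>j\<in>UNIV. partial j (partial j v) x)"

definition advect :: "(real^3 \<Rightarrow> real^3) \<Rightarrow> (real^3 \<Rightarrow> 'b::real_normed_vector) \<Rightarrow> real^3 \<Rightarrow> 'b" where
  "advect v f x = (\<Sum>k\<in>UNIV. v x $ k *\<^sub>R partial k f x)"


section \<open>Matrices\<close>

text \<open>The library norm on \<^typ>\<open>real^3^3\<close> is already the Frobenius norm.\<close>

definition frob :: "real^3^3 \<Rightarrow> real^3^3 \<Rightarrow> real" where
  "frob M N = trace (M ** transpose N)"

definition outer :: "real^3 \<Rightarrow> real^3 \<Rightarrow> real^3^3" where
  "outer v w = (\<chi> i j. v $ i * w $ j)"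

definition mat_exp :: "real^3^3 \<Rightarrow> real^3^3" where
  "mat_exp M = (\<Sum>n. (1 / fact n) *\<^sub>R (((**) M ^^ n) (mat 1)))"


section \<open>Residuals and the anti-divergence\<close>

definition conf_residual ::
  "real \<Rightarrow> real set \<Rightarrow> (real \<Rightarrow> real^3 \<Rightarrow> real^3) \<Rightarrow> (real \<Rightarrow> real^3 \<Rightarrow> real^3^3)
    \<Rightarrow> real \<Rightarrow> real^3 \<Rightarrow> real^3^3" where
  "conf_residual lam J u B t x =
     (let A = (\<lambda>s y. mat_exp (B s y)) in
        time_deriv J A t x + advect (u t) (A t) x
        - vgrad (u t) x ** A t x - A t x ** transpose (vgrad (u t) x)
        + (1 / lam) *\<^sub>R (A t x - mat 1))"

definition mom_residual ::
  "real \<Rightarrow> real \<Rightarrow> real set \<Rightarrow> (real \<Rightarrow> real^3 \<Rightarrow> real^3) \<Rightarrow> (real \<Rightarrow> real^3 \<Rightarrow> real^3^3)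
    \<Rightarrow> real \<Rightarrow> real^3 \<Rightarrow> real^3" where
  "mom_residual \<nu> \<alpha> J u B t x =
     time_deriv J u t x + mdiv (\<lambda>y. outer (u t y) (u t y)) x
     - \<nu> *\<^sub>R vlaplacian (u t) x - \<alpha> *\<^sub>R mdiv (\<lambda>y. mat_exp (B t y) - mat 1) x"

definition antidiv_potential :: "(real^3 \<Rightarrow> real^3) \<Rightarrow> real^3 \<Rightarrow> real^3" where
  "antidiv_potential m =
     (THE \<phi>. smooth_on \<phi> UNIV \<and> periodic \<phi> \<and> spatial_mean \<phi> = 0 \<and>
             (\<forall>x. vlaplacian \<phi> x + (1 / 3) *\<^sub>R sgrad (vdiv \<phi>) x = m x))"

definition antidiv :: "(real^3 \<Rightarrow> real^3) \<Rightarrow> real^3 \<Rightarrow> real^3^3" where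
  "antidiv m x =
     (let \<phi> = antidiv_potential m in
        (\<chi> i j. partial i (\<lambda>y. \<phi> y $ j) x + partial j (\<lambda>y. \<phi> y $ i) x
               - (2 / 3) * (if i = j then vdiv \<phi> x else 0)))"

definition residual_work ::
  "real \<Rightarrow> real \<Rightarrow> real set \<Rightarrow> (real \<Rightarrow> real^3 \<Rightarrow> real^3) \<Rightarrow> (real \<Rightarrow> real^3 \<Rightarrow> real^3^3)
    \<Rightarrow> real \<Rightarrow> real" where
  "residual_work \<nu> \<alpha> J u B t =
     (LINT x:torus_cell|lebesgue.
        - frob (antidiv (mom_residual \<nu> \<alpha> J u B t) x) (sym_grad (u t) x))"


section \<open>Reynolds states\<close>

text \<open>
  The momentum defect is only determined modulo pressure tensors \<open>q I\<close>; the field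
  \<open>mom_defect\<close> holds the pressure-free representative.  As \<open>div u = 0\<close>, pressure tensors do
  not contribute to the contraction with the symmetric gradient.
\<close>

record reynolds_state =
  times :: "real set"
  velocity :: "real \<Rightarrow> real^3 \<Rightarrow> real^3"
  pressure :: "real \<Rightarrow> real^3 \<Rightarrow> real"
  log_conf :: "real \<Rightarrow> real^3 \<Rightarrow> real^3^3"
  conf_defect :: "real \<Rightarrow> real^3 \<Rightarrow> real^3^3"
  mom_defect :: "real \<Rightarrow> real^3 \<Rightarrow> real^3^3"

definition residual_matching_state ::
  "real \<Rightarrow> real \<Rightarrow> real \<Rightarrow> real set \<Rightarrow> (real \<Rightarrow> real^3 \<Rightarrow> real^3) \<Rightarrow> (real \<Rightarrow> real^3 \<Rightarrow> real)
    \<Rightarrow> (real \<Rightarrow> real^3 \<Rightarrow> real^3^3) \<Rightarrow> reynolds_state" where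
  "residual_matching_state \<nu> \<alpha> lam J u p B =
     \<lparr> times = J, velocity = u, pressure = p, log_conf = B,
       conf_defect = conf_residual lam J u B,
       mom_defect = (\<lambda>t. antidiv (mom_residual \<nu> \<alpha> J u B t)) \<rparr>"

definition energy_entropy_admissible :: "real \<Rightarrow> reynolds_state \<Rightarrow> bool" where
  "energy_entropy_admissible \<alpha> st \<longleftrightarrow>
     (AE t in lebesgue. t \<in> times st \<longrightarrow>
        (LINT x:torus_cell|lebesgue.
           - frob (mom_defect st t x) (sym_grad (velocity st t) x)
           + \<alpha> / 2 * frob (mat 1 - matrix_inv (mat_exp (log_conf st t x))) (conf_defect st t x))
        \<le> 0)"


section \<open>Lebesgue norms on space-time sets\<close>

text \<open>Both norms may be infinite, e.g. on windows reaching an open end of the time interval.\<close>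

definition Linf_norm :: "'a::euclidean_space set \<Rightarrow> ('a \<Rightarrow> 'b::real_normed_vector) \<Rightarrow> ennreal" where
  "Linf_norm S f = esssup (lebesgue_on S) (\<lambda>z. ennreal (norm (f z)))"

definition L2_norm :: "'a::euclidean_space set \<Rightarrow> ('a \<Rightarrow> 'b::real_normed_vector) \<Rightarrow> ennreal" where
  "L2_norm S f =
     (let I = (\<integral>\<^sup>+z. ennreal ((norm (f z))\<^sup>2) \<partial>lebesgue_on S) in
        if I = \<infinity> then \<infinity> else ennreal (sqrt (enn2real I)))"

end

theory Submission
  imports Defs
begin

text \<open>
  At almost every time, admissibility says that the residual work is at most the entropy term
  \<open>\<alpha>/2 \<integral> |I - A\<inverse>| |S|\<close> with \<open>A = exp B\<close>.  Where \<open>B\<close> is small the factor \<open>I - A\<inverse> = I - exp (- B)\<close> is small too: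
  its Frobenius norm is at most \<open>\<epsilon> e\<close> if \<open>|B| \<le> \<epsilon> \<le> 1\<close>.  So the positive part of the work is at
  most \<open>\<alpha>/2 \<epsilon> e \<integral> |S|\<close>, and a fixed amount of work over the window forces the \<open>L\<^sup>1\<close> norm of \<open>S\<close>, hence by
  Cauchy--Schwarz its \<open>L\<^sup>2\<close> norm, to be at least of order \<open>1/\<epsilon>\<close>.

  The algebraic part is \<open>matrix_inv_mat_exp\<close>, which identifies the inverse of \<open>exp B\<close>, and
  \<open>norm_mat_exp_diff\<close>, the bound on \<open>exp M - I\<close>.  The analytic part is that \<open>S\<close> is continuous in space
  and time (\<open>continuous_on_conf_residual\<close>), so that all integrals of \<open>S\<close> are meaningful and Tonelli's
  theorem applies; for this the matrix exponential is differentiated term by term.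

  The density of the residual work contains the anti-divergence, a solution of an elliptic system.  The
  inequality \<open>set_integral_positive_part_le\<close> avoids solving that system: if the density is
  integrable, the admissibility integral splits into the work and the entropy term, and otherwise the
  work is zero by convention and has no positive part.
\<close>

section \<open>The Frobenius norm\<close>

lemma norm_matrix_power2:
  fixes A :: "real^'n^'m"
  shows "(norm A)\<^sup>2 = (\<Sum>i\<in>UNIV. (norm (row i A))\<^sup>2)"
  by (simp add: norm_vec_def L2_set_def sum_nonneg row_def vec_lambda_eta)

lemma norm_transpose:
  fixes A :: "real^'n^'m"
  shows "norm (transpose A) = norm A"
proof -
  have "(norm (transpose A))\<^sup>2 = (norm A)\<^sup>2"
    unfolding norm_matrix_power2 row_def transpose_def norm_vec_def L2_set_def
    by (simp add: sum_nonneg) (rule sum.swap)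
  then show ?thesis by simp
qed

text \<open>
Every entry of the product is an inner product of a row and a column, and the Cauchy--Schwarz
bounds of the squared entries sum to the product of the squared norms.
\<close>

lemma norm_matrix_mult:
  fixes A :: "real^'n^'m" and B :: "real^'k^'n"
  shows "norm (A ** B) \<le> norm A * norm B"
proof -
  have "(norm (A ** B))\<^sup>2 = (\<Sum>i\<in>UNIV. \<Sum>j\<in>UNIV. (row i A \<bullet> column j B)\<^sup>2)"
    unfolding norm_matrix_power2 norm_vec_def L2_set_def
    by (simp add: sum_nonneg row_def column_def matrix_matrix_mult_def inner_vec_def)
  also have "\<dots> \<le> (\<Sum>i\<in>UNIV. \<Sum>j\<in>UNIV. (norm (row i A))\<^sup>2 * (norm (column j B))\<^sup>2)"
    by (intro sum_mono) (simp add: Cauchy_Schwarz_ineq power2_norm_eq_inner)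
  also have "\<dots> = (norm A)\<^sup>2 * (norm (transpose B))\<^sup>2"
    unfolding norm_matrix_power2 by (simp add: sum_product)
  finally have "(norm (A ** B))\<^sup>2 \<le> (norm A * norm B)\<^sup>2"
    by (simp add: norm_transpose power_mult_distrib)
  then show ?thesis
    by (rule power2_le_imp_le) simp
qed

lemma bounded_bilinear_matrix_mult:
  "bounded_bilinear ((**) :: real^'n^'m \<Rightarrow> real^'k^'n \<Rightarrow> real^'k^'m)"
proof (rule bounded_bilinear.intro)
  show "\<exists>K. \<forall>(a :: real^'n^'m) (b :: real^'k^'n). norm (a ** b) \<le> norm a * norm b * K"
    by (rule exI[of _ 1]) (simp add: norm_matrix_mult)
qed (simp_all add: vec_eq_iff matrix_matrix_mult_def sum_distrib_left sum.distrib algebra_simps)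

interpretation matmul: bounded_bilinear "(**) :: real^'n^'m \<Rightarrow> real^'k^'n \<Rightarrow> real^'k^'m"
  by (rule bounded_bilinear_matrix_mult)

lemma frob_eq_inner: "frob M N = M \<bullet> N"
  by (simp add: frob_def trace_def matrix_matrix_mult_def transpose_def inner_vec_def)

lemma matrix_inv_eqI:
  fixes A :: "real^'n^'n"
  assumes "A ** B = mat 1"
  shows "matrix_inv A = B"
proof -
  have BA: "B ** A = mat 1" using assms matrix_left_right_inverse by blast
  then have "A ** matrix_inv A = mat 1"
    using assms unfolding matrix_inv_def by (metis (mono_tags, lifting) someI_ex)
  then have "B ** (A ** matrix_inv A) = B" by simp
  then show ?thesis by (simp add: matrix_mul_assoc BA)
qed

text \<open>
The Frobenius norm of the identity is \<open>\<surd>3\<close>, so the matrices form no normed algebra with unit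
of norm one.  Powers with exponent zero therefore cost an extra factor, and \<open>2\<close> is enough.
\<close>

lemma norm_mat1: "norm (mat 1 :: real^3^3) \<le> 2"
proof -
  have "(norm (mat 1 :: real^3^3))\<^sup>2 = 3"
    by (simp add: power2_norm_eq_inner inner_vec_def mat_def sum_3)
  then have "(norm (mat 1 :: real^3^3))\<^sup>2 \<le> 2\<^sup>2" by simp
  then show ?thesis by (rule power2_le_imp_le) simp
qed

section \<open>Termwise differentiation of series\<close>

text \<open>
A series may be differentiated term by term if the operator norms of the derivatives have a
summable majorant: the tail of the derivative series is then small relative to \<open>norm h\<close>,
uniformly on \<open>S\<close>.
\<close>

lemma has_derivative_series_M_test:
  fixes f :: "nat \<Rightarrow> 'a::real_normed_vector \<Rightarrow> 'b::banach"
  assumes S: "convex S" "open S" and x: "x \<in> S"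
    and f: "\<And>n x. x \<in> S \<Longrightarrow> (f n has_derivative f' n x) (at x)"
    and bound: "\<And>n x h. x \<in> S \<Longrightarrow> norm (f' n x h) \<le> c n * norm h"
    and c: "summable c" and sf: "summable (\<lambda>n. f n x)"
  shows "((\<lambda>x. \<Sum>n. f n x) has_derivative (\<lambda>h. \<Sum>n. f' n x h)) (at x)"
proof -
  have sh: "summable (\<lambda>n. f' n y h)" if "y \<in> S" for y h
    by (rule summable_comparison_test'[OF summable_mult2[OF c, of "norm h"]]) (use bound that in auto)
  have "\<exists>g. \<forall>y\<in>S. (\<lambda>n. f n y) sums (g y) \<and>
          (g has_derivative (\<lambda>h. \<Sum>n. f' n y h)) (at y within S)"
  proof (rule has_derivative_series[OF S(1)])
    show "(f n has_derivative f' n y) (at y within S)" if "y \<in> S" for n y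
      using f[OF that] by (rule has_derivative_at_withinI)
    show "x \<in> S" by (rule x)
    show "(\<lambda>n. f n x) sums (\<Sum>n. f n x)" by (rule summable_sums[OF sf])
    fix e :: real assume "e > 0"
    then obtain N where N: "\<And>n. n \<ge> N \<Longrightarrow> norm (\<Sum>i. c (i + n)) < e"
      using suminf_exist_split[OF _ c] by blast
    have "norm ((\<Sum>i<n. f' i y h) - (\<Sum>i. f' i y h)) \<le> e * norm h"
      if n: "n \<ge> N" and y: "y \<in> S" for n y h
    proof -
      have "(\<Sum>i<n. f' i y h) - (\<Sum>i. f' i y h) = - (\<Sum>i. f' (i + n) y h)"
        using suminf_split_initial_segment[OF sh[OF y], of h n] by simp
      then have "norm ((\<Sum>i<n. f' i y h) - (\<Sum>i. f' i y h)) = norm (\<Sum>i. f' (i + n) y h)"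
        by simp
      also have "\<dots> \<le> (\<Sum>i. c (i + n) * norm h)"
        by (rule norm_suminf_le[OF bound[OF y]]) (use c in \<open>simp add: summable_mult2\<close>)
      also have "\<dots> = (\<Sum>i. c (i + n)) * norm h"
        by (rule suminf_mult2[symmetric]) (use c in simp)
      also have "\<dots> \<le> e * norm h"
        using N[OF n] by (intro mult_right_mono) auto
      finally show ?thesis .
    qed
    then show "\<forall>\<^sub>F n in sequentially. \<forall>y\<in>S. \<forall>h.
        norm ((\<Sum>i<n. f' i y h) - (\<Sum>n. f' n y h)) \<le> e * norm h"
      unfolding eventually_sequentially by blast
  qed
  then obtain g where g: "\<And>y. y \<in> S \<Longrightarrow> (\<lambda>n. f n y) sums (g y)"
    "(g has_derivative (\<lambda>h. \<Sum>n. f' n x h)) (at x within S)" using x by blast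
  have "(g has_derivative (\<lambda>h. \<Sum>n. f' n x h)) (at x)"
    using g(2) at_within_open[OF x S(2)] by simp
  then show ?thesis
    by (rule has_derivative_transform_within_open[OF _ S(2) x]) (use g(1) sums_unique in blast)
qed

section \<open>The matrix exponential\<close>

abbreviation mpow :: "nat \<Rightarrow> real^3^3 \<Rightarrow> real^3^3" where
  "mpow n M \<equiv> ((**) M ^^ n) (mat 1)"

text \<open>
The derivative of \<open>M \<mapsto> M\<^sup>n\<close> in direction \<open>H\<close>, that is \<open>\<Sum>i<n. M\<^sup>i H M\<^sup>n\<^sup>-\<^sup>1\<^sup>-\<^sup>i\<close>, generated by the Leibniz rule
because \<open>M\<close> and \<open>H\<close> need not commute.
\<close>

primrec dpow :: "nat \<Rightarrow> real^3^3 \<Rightarrow> real^3^3 \<Rightarrow> real^3^3" where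
  "dpow 0 M H = 0"
| "dpow (Suc n) M H = H ** mpow n M + M ** dpow n M H"

lemma norm_mpow_Suc: "norm (mpow (Suc n) M) \<le> norm M ^ Suc n"
proof (induction n)
  case (Suc n)
  have "norm (mpow (Suc (Suc n)) M) \<le> norm M * norm (mpow (Suc n) M)"
    using norm_matrix_mult[of M "mpow (Suc n) M"] by simp
  also have "\<dots> \<le> norm M * norm M ^ Suc n"
    by (intro mult_left_mono Suc) simp
  finally show ?case by simp
qed simp

lemma norm_mpow: "norm (mpow n M) \<le> 2 * norm M ^ n"
proof (cases n)
  case 0
  then show ?thesis using norm_mat1 by simp
next
  case (Suc m)
  then show ?thesis using norm_mpow_Suc[of m M] by (smt (verit) norm_ge_zero zero_le_power)
qed

text \<open>
The factor \<open>R\<^sup>n\<close> in place of the sharp \<open>R\<^sup>n\<^sup>-\<^sup>1\<close> avoids truncated exponents; \<open>1 \<le> R\<close> pays for it.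
\<close>

lemma norm_dpow:
  assumes "norm M \<le> R" "1 \<le> R"
  shows "norm (dpow n M H) \<le> 2 * real n * R ^ n * norm H"
proof (induction n)
  case (Suc n)
  have *: "norm (mpow n M) \<le> 2 * R ^ Suc n"
  proof -
    have "norm (mpow n M) \<le> 2 * norm M ^ n" by (rule norm_mpow)
    also have "\<dots> \<le> 2 * R ^ n" using assms by (simp add: power_mono)
    also have "\<dots> \<le> 2 * R ^ Suc n" using assms by simp
    finally show ?thesis .
  qed
  have "norm (dpow (Suc n) M H) \<le> norm (H ** mpow n M) + norm (M ** dpow n M H)"
    by (simp add: norm_triangle_ineq)
  also have "\<dots> \<le> norm H * norm (mpow n M) + norm M * norm (dpow n M H)"
    by (intro add_mono norm_matrix_mult)
  also have "\<dots> \<le> norm H * (2 * R ^ Suc n) + R * (2 * real n * R ^ n * norm H)"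
    using assms by (intro add_mono mult_mono * Suc order_refl) auto
  also have "\<dots> = 2 * real (Suc n) * R ^ Suc n * norm H"
    by (simp add: algebra_simps)
  finally show ?case .
qed simp

lemma has_derivative_mpow: "(mpow n has_derivative dpow n M) (at M)"
proof (induction n)
  case 0
  then show ?case by (auto simp: id_def)
next
  case (Suc n)
  have "((\<lambda>M. M ** mpow n M) has_derivative (\<lambda>H. M ** dpow n M H + H ** mpow n M)) (at M)"
    by (rule matmul.FDERIV[OF has_derivative_ident Suc])
  then show ?case by (simp add: add.commute[of "_ ** mpow n M"])
qed

lemma continuous_mpow: "continuous_on UNIV (mpow n)"
  by (rule continuous_at_imp_continuous_on) (blast intro: has_derivative_continuous has_derivative_mpow)

lemma continuous_dpow: "continuous_on UNIV (\<lambda>z. dpow n (fst z) (snd z))"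
proof (induction n)
  case (Suc n)
  have "continuous_on UNIV (\<lambda>z::(real^3^3) \<times> (real^3^3). mpow n (fst z))"
    by (rule continuous_on_compose2[OF continuous_mpow[of n]]) (auto intro!: continuous_intros)
  with Suc show ?case
    by (auto intro!: continuous_intros matmul.continuous_on)
qed simp

definition dexp :: "real^3^3 \<Rightarrow> real^3^3 \<Rightarrow> real^3^3" where
  "dexp M H = (\<Sum>n. (1 / fact n) *\<^sub>R dpow n M H)"

lemma summable_mat_exp: "summable (\<lambda>n. (1 / fact n) *\<^sub>R mpow n M)"
proof (rule summable_comparison_test')
  show "summable (\<lambda>n. 2 * (inverse (fact n) * norm M ^ n))"
    by (intro summable_mult summable_exp)
  show "norm ((1 / fact n) *\<^sub>R mpow n M) \<le> 2 * (inverse (fact n) * norm M ^ n)" for n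
    using mult_left_mono[OF norm_mpow[of n M], of "1 / fact n"] by (simp add: field_simps)
qed

definition dexp_majorant :: "real \<Rightarrow> nat \<Rightarrow> real" where
  "dexp_majorant R n = 2 * real n * R ^ n / fact n"

lemma norm_dexp_term:
  assumes "norm M \<le> R" "1 \<le> R"
  shows "norm ((1 / fact n) *\<^sub>R dpow n M H) \<le> dexp_majorant R n * norm H"
  using mult_left_mono[OF norm_dpow[OF assms, of n H], of "1 / fact n"]
  by (simp add: dexp_majorant_def field_simps)

lemma summable_dexp_majorant: assumes "1 \<le> R" shows "summable (dexp_majorant R)"
proof (rule summable_comparison_test')
  show "summable (\<lambda>n. 2 * (inverse (fact n) * (2 * R) ^ n))"
    by (intro summable_mult summable_exp)
  fix n
  have "real n \<le> 2 ^ n" by (metis less_exp less_imp_le of_nat_le_iff of_nat_numeral of_nat_power)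
  then have "real n * R ^ n \<le> (2 * R) ^ n" using assms by (simp add: power_mult_distrib mult_right_mono)
  then show "norm (dexp_majorant R n) \<le> 2 * (inverse (fact n) * (2 * R) ^ n)"
    using assms by (simp add: dexp_majorant_def abs_mult divide_simps)
qed

lemma has_derivative_mat_exp: "(mat_exp has_derivative dexp M) (at M)"
proof -
  define R where "R = norm M + 1"
  have R: "1 \<le> R" by (simp add: R_def)
  have "((\<lambda>M. \<Sum>n. (1 / fact n) *\<^sub>R mpow n M) has_derivative (\<lambda>H. \<Sum>n. (1 / fact n) *\<^sub>R dpow n M H)) (at M)"
  proof (rule has_derivative_series_M_test[where S = "ball 0 R" and c = "dexp_majorant R"])
    show "M \<in> ball 0 R" by (simp add: R_def)
    show "((\<lambda>M. (1 / fact n) *\<^sub>R mpow n M) has_derivative (\<lambda>H. (1 / fact n) *\<^sub>R dpow n M H)) (at M)" for n M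
      by (intro has_derivative_scaleR_right has_derivative_mpow)
    show "norm ((1 / fact n) *\<^sub>R dpow n M H) \<le> dexp_majorant R n * norm H" if "M \<in> ball 0 R" for n M H
      by (rule norm_dexp_term) (use that R in auto)
  qed (auto simp: summable_dexp_majorant R summable_mat_exp)
  then show ?thesis by (simp add: mat_exp_def[abs_def] dexp_def[abs_def])
qed

lemma continuous_mat_exp: "continuous_on UNIV mat_exp"
  by (meson continuous_at_imp_continuous_on has_derivative_continuous has_derivative_mat_exp)

text \<open>
The derivative series converges uniformly on balls of \<open>(M, H)\<close>, and its partial sums are
continuous.  Joint continuity is needed because \<open>M\<close> and \<open>H\<close> both vary with the space-time point
when \<open>exp B\<close> is differentiated.
\<close>

lemma continuous_dexp: "continuous_on UNIV (\<lambda>z. dexp (fst z) (snd z))"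
proof (rule continuous_at_imp_continuous_on, rule ballI)
  fix z0 :: "(real^3^3) \<times> (real^3^3)"
  define R where "R = norm z0 + 1"
  have R: "1 \<le> R" by (simp add: R_def)
  have "uniform_limit (ball 0 R)
      (\<lambda>N z. \<Sum>n<N. (1 / fact n) *\<^sub>R dpow n (fst z) (snd z)) (\<lambda>z. dexp (fst z) (snd z)) sequentially"
    unfolding dexp_def
  proof (rule Weierstrass_m_test)
    fix n and z :: "(real^3^3) \<times> (real^3^3)" assume "z \<in> ball 0 R"
    then have *: "norm (fst z) \<le> R" "norm (snd z) \<le> R"
      using norm_fst_le[of "fst z" "snd z"] norm_snd_le[of "snd z" "fst z"] by auto
    have "norm ((1 / fact n) *\<^sub>R dpow n (fst z) (snd z)) \<le> dexp_majorant R n * norm (snd z)"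
      by (rule norm_dexp_term[OF *(1) R])
    also have "\<dots> \<le> dexp_majorant R n * R"
      using *(2) R by (intro mult_left_mono) (auto simp: dexp_majorant_def)
    finally show "norm ((1 / fact n) *\<^sub>R dpow n (fst z) (snd z)) \<le> dexp_majorant R n * R" .
  qed (intro summable_mult2 summable_dexp_majorant R)
  then have "continuous_on (ball 0 R) (\<lambda>z. dexp (fst z) (snd z))"
    by (rule uniform_limit_theorem[rotated])
       (auto intro!: always_eventually continuous_intros continuous_on_subset[OF continuous_dpow])
  moreover have "z0 \<in> ball 0 R" by (simp add: R_def)
  ultimately show "isCont (\<lambda>z. dexp (fst z) (snd z)) z0"
    using continuous_on_eq_continuous_at open_ball by blast
qed

lemma mpow_commute:
  assumes "M ** H = H ** M" shows "mpow n M ** H = H ** mpow n M"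
  by (induction n) (simp_all, metis assms matrix_mul_assoc)

lemma mat_exp_commute:
  assumes "M ** H = H ** M" shows "mat_exp M ** H = H ** mat_exp M"
proof -
  have "mat_exp M ** H = (\<Sum>n. ((1 / fact n) *\<^sub>R mpow n M) ** H)"
    unfolding mat_exp_def
    by (rule bounded_linear.suminf[OF matmul.bounded_linear_left summable_mat_exp])
  also have "\<dots> = (\<Sum>n. H ** ((1 / fact n) *\<^sub>R mpow n M))"
    by (simp add: matmul.scaleR_left matmul.scaleR_right mpow_commute[OF assms])
  also have "\<dots> = H ** mat_exp M"
    unfolding mat_exp_def
    by (rule bounded_linear.suminf[OF matmul.bounded_linear_right summable_mat_exp, symmetric])
  finally show ?thesis .
qed

text \<open>
If \<open>M\<close> and \<open>H\<close> commute, all \<open>n\<close> summands \<open>M\<^sup>i H M\<^sup>n\<^sup>-\<^sup>1\<^sup>-\<^sup>i\<close> of the derivative coincide.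
\<close>

lemma dpow_commute:
  assumes "M ** H = H ** M"
  shows "dpow (Suc n) M H = real (Suc n) *\<^sub>R (H ** mpow n M)"
proof (induction n)
  case (Suc n)
  have "M ** (H ** mpow n M) = H ** mpow (Suc n) M"
    by (simp add: matrix_mul_assoc assms)
  then have "dpow (Suc (Suc n)) M H = H ** mpow (Suc n) M + real (Suc n) *\<^sub>R (H ** mpow (Suc n) M)"
    using Suc by (simp add: matmul.scaleR_right del: funpow.simps of_nat_Suc)
  then show ?case
    by (simp only: of_nat_Suc scaleR_left_distrib scaleR_one)
qed simp

lemma dexp_commute:
  assumes "M ** H = H ** M" shows "dexp M H = H ** mat_exp M"
proof -
  have s: "summable (\<lambda>n. (1 / fact n) *\<^sub>R dpow n M H)"
    by (rule summable_comparison_test'[OF summable_mult2[OF summable_dexp_majorant[of "norm M + 1"], of "norm H"]])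
       (auto intro!: norm_dexp_term simp del: norm_scaleR)
  have eq: "(1 / fact (Suc n)) *\<^sub>R dpow (Suc n) M H = H ** ((1 / fact n) *\<^sub>R mpow n M)" for n
    unfolding dpow_commute[OF assms] fact_Suc
    by (simp add: matmul.scaleR_right nonzero_divide_mult_cancel_left del: of_nat_Suc)
  have "dexp M H = (\<Sum>n. (1 / fact (Suc n)) *\<^sub>R dpow (Suc n) M H)"
    using suminf_split_head[OF s] by (simp add: dexp_def)
  also have "\<dots> = (\<Sum>n. H ** ((1 / fact n) *\<^sub>R mpow n M))"
    unfolding eq ..
  also have "\<dots> = H ** mat_exp M"
    unfolding mat_exp_def
    by (rule bounded_linear.suminf[OF matmul.bounded_linear_right summable_mat_exp, symmetric])
  finally show ?thesis .
qed

text \<open>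
The series without its constant term is dominated by \<open>exp b - 1\<close> with \<open>b = norm M\<close>, and
\<open>1 - b \<le> exp (- b)\<close> gives \<open>exp b - 1 \<le> b exp b\<close>.  The factor \<open>e\<close> of the final bound is \<open>exp b\<close> for \<open>b \<le> 1\<close>.
\<close>

lemma norm_mat_exp_diff: "norm (mat_exp M - mat 1) \<le> norm M * exp (norm M)"
proof -
  have e: "(\<lambda>n. norm M ^ n / fact n) sums exp (norm M)"
    using exp_converges[of "norm M"] by (simp add: divide_inverse mult.commute)
  have sumr: "summable (\<lambda>n. norm M ^ Suc n / fact (Suc n))"
    using sums_summable[OF e] by (subst summable_Suc_iff)
  have "mat_exp M - mat 1 = (\<Sum>n. (1 / fact (Suc n)) *\<^sub>R mpow (Suc n) M)"
    using suminf_split_head[OF summable_mat_exp[of M]] by (simp add: mat_exp_def)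
  also have "norm \<dots> \<le> (\<Sum>n. norm M ^ Suc n / fact (Suc n))"
  proof (rule norm_suminf_le[OF _ sumr])
    show "norm ((1 / fact (Suc n)) *\<^sub>R mpow (Suc n) M) \<le> norm M ^ Suc n / fact (Suc n)" for n
      using divide_right_mono[OF norm_mpow_Suc[of n M], of "fact (Suc n)"]
      by (simp del: funpow.simps power_Suc fact_Suc)
  qed
  also have "\<dots> = exp (norm M) - 1"
    using suminf_split_head[OF sums_summable[OF e]] sums_unique[OF e] by simp
  also have "\<dots> \<le> norm M * exp (norm M)"
  proof -
    have "(1 - norm M) * exp (norm M) \<le> exp (- norm M) * exp (norm M)"
      using exp_ge_add_one_self[of "- norm M"] by (intro mult_right_mono) auto
    then show ?thesis by (simp add: algebra_simps flip: exp_add)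
  qed
  finally show ?thesis .
qed

lemma mat_exp_0: "mat_exp 0 = mat 1"
  using norm_mat_exp_diff[of 0] by simp

text \<open>
The path \<open>s \<mapsto> exp (s M) exp (- s M)\<close> has zero derivative, since \<open>M\<close> commutes with \<open>exp (s M)\<close>, and
it starts at the identity.
\<close>

lemma mat_exp_inverse: "mat_exp M ** mat_exp (- M) = mat 1"
proof -
  define g where "g s = mat_exp (s *\<^sub>R M) ** mat_exp (s *\<^sub>R (- M))" for s :: real
  have d: "((\<lambda>s. mat_exp (s *\<^sub>R K)) has_derivative (\<lambda>h. h *\<^sub>R (K ** mat_exp (s *\<^sub>R K)))) (at s)" for K s
  proof -
    have "((\<lambda>s. mat_exp (s *\<^sub>R K)) has_derivative (\<lambda>h. dexp (s *\<^sub>R K) (h *\<^sub>R K))) (at s)"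
      by (rule has_derivative_compose[OF _ has_derivative_mat_exp])
         (auto intro!: derivative_eq_intros)
    then show ?thesis
      by (simp add: dexp_commute matmul.scaleR_left matmul.scaleR_right)
  qed
  have "(g has_derivative (\<lambda>h. 0)) (at s)" for s
  proof -
    have c: "mat_exp (s *\<^sub>R M) ** M = M ** mat_exp (s *\<^sub>R M)"
      by (rule mat_exp_commute) (simp add: matmul.scaleR_left matmul.scaleR_right)
    have "mat_exp (s *\<^sub>R M) ** (h *\<^sub>R (- M ** mat_exp (s *\<^sub>R - M)))
        + (h *\<^sub>R (M ** mat_exp (s *\<^sub>R M))) ** mat_exp (s *\<^sub>R - M) = 0" for h
      using c by (simp add: matmul.scaleR_left matmul.scaleR_right matmul.minus_left matmul.minus_right
          matrix_mul_assoc)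
    with matmul.FDERIV[OF d[of M s] d[of "- M" s]] show ?thesis
      unfolding g_def by simp
  qed
  then have "g 1 = g 0"
    using has_derivative_zero_unique_connected[of UNIV g] by (metis connected_UNIV UNIV_I open_UNIV)
  then show ?thesis by (simp add: g_def mat_exp_0)
qed

lemma matrix_inv_mat_exp: "matrix_inv (mat_exp M) = mat_exp (- M)"
  by (rule matrix_inv_eqI[OF mat_exp_inverse])

section \<open>Continuity of the conformation residual\<close>

text \<open>
Only the first derivatives of the fields enter the conformation residual.
\<close>

lemma smooth_fieldE:
  assumes "smooth_field J f"
  obtains f' where
    "\<And>z. z \<in> J \<times> UNIV \<Longrightarrow> ((\<lambda>(t, x). f t x) has_derivative f' z) (at z within J \<times> UNIV)"
    "\<And>v. continuous_on (J \<times> UNIV) (\<lambda>z. f' z v)"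
    "continuous_on (J \<times> UNIV) (\<lambda>z. f (fst z) (snd z))"
proof -
  have "Ck_on (Suc 0) (\<lambda>(t, x). f t x) (J \<times> UNIV)" "Ck_on 0 (\<lambda>(t, x). f t x) (J \<times> UNIV)"
    using assms unfolding smooth_field_def smooth_on_def by blast+
  then show ?thesis using that by (auto simp: case_prod_beta')
qed

text \<open>
The residual is built from slice derivatives, while smoothness is stated for the joint space-time
derivative \<open>f'\<close>; the chain rule along coordinate lines connects the two.
\<close>

lemma partial_spacetime:
  fixes f :: "real \<Rightarrow> real^3 \<Rightarrow> 'b::real_normed_vector"
  assumes f: "((\<lambda>(t, x). f t x) has_derivative f') (at (t, x) within J \<times> UNIV)" and t: "t \<in> J"
  shows "partial k (f t) x = f' (0, axis k 1)"
proof -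
  let ?c = "\<lambda>h::real. (t, x + h *\<^sub>R axis k (1::real))"
  have c: "(?c has_derivative (\<lambda>h. (0, h *\<^sub>R axis k 1))) (at 0)"
    by (auto intro!: derivative_eq_intros)
  have "((\<lambda>(t, x). f t x) has_derivative f') (at (?c 0) within ?c ` UNIV)"
    using f t by (auto intro: has_derivative_subset)
  from has_derivative_in_compose[OF c this]
  have "((\<lambda>h. f t (x + h *\<^sub>R axis k 1)) has_derivative (\<lambda>h. f' (0, h *\<^sub>R axis k 1))) (at 0)"
    by simp
  moreover have "(\<lambda>h. f' (0, h *\<^sub>R axis k 1)) = (\<lambda>h. h *\<^sub>R f' (0, axis k 1))"
  proof
    fix h show "f' (0, h *\<^sub>R axis k 1) = h *\<^sub>R f' (0, axis k 1)"
      using linear_scale[OF has_derivative_linear[OF f], of h "(0, axis k 1)"] by simp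
  qed
  ultimately show ?thesis
    unfolding partial_def by (intro vector_derivative_at) (simp only: has_vector_derivative_def)
qed

text \<open>
At an endpoint of \<open>J\<close> the time derivative is one-sided, and it is determined as soon as \<open>t\<close> is not
isolated in \<open>J\<close>.
\<close>

lemma time_deriv_spacetime:
  fixes f :: "real \<Rightarrow> real^3 \<Rightarrow> 'b::real_normed_vector"
  assumes f: "((\<lambda>(t, x). f t x) has_derivative f') (at (t, x) within J \<times> UNIV)"
    and t: "t \<in> J" and J: "at t within J \<noteq> bot"
  shows "time_deriv J f t x = f' (1, 0)"
proof -
  have c: "((\<lambda>s. (s, x)) has_derivative (\<lambda>h. (h, 0))) (at t within J)"
    by (auto intro!: derivative_eq_intros)
  have "((\<lambda>(t, x). f t x) has_derivative f') (at (t, x) within (\<lambda>s. (s, x)) ` J)"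
    using f by (rule has_derivative_subset) auto
  from has_derivative_in_compose[OF c this]
  have "((\<lambda>s. f s x) has_derivative (\<lambda>h. f' (h, 0))) (at t within J)"
    by simp
  moreover have "(\<lambda>h. f' (h, 0)) = (\<lambda>h. h *\<^sub>R f' (1, 0))"
  proof
    fix h show "f' (h, 0) = h *\<^sub>R f' (1, 0)"
      using linear_scale[OF has_derivative_linear[OF f], of h "(1, 0)"] by simp
  qed
  ultimately show ?thesis
    unfolding time_deriv_def by (intro vector_derivative_within[OF J]) (simp only: has_vector_derivative_def)
qed

lemma at_within_interval_neq_bot:
  fixes J :: "real set"
  assumes "is_interval J" "interior J \<noteq> {}" "t \<in> J"
  shows "at t within J \<noteq> bot"
proof -
  have "J \<noteq> {t}" using assms(2) by auto
  then show ?thesis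
    using connected_imp_perfect[of J t] assms is_interval_connected
    by (auto simp: trivial_limit_within)
qed

text \<open>
Expressed through the space-time derivatives \<open>u'\<close> and \<open>B'\<close> and the derivative \<open>dexp\<close>, the residual
is an algebraic combination of continuous functions.  Continuity provides the joint measurability
for Tonelli's theorem and the integrability on the compact cell.
\<close>

lemma continuous_on_conf_residual:
  assumes J: "is_interval J" "interior J \<noteq> {}"
    and u: "smooth_field J u" and B: "smooth_field J B"
  shows "continuous_on (J \<times> UNIV) (\<lambda>(t, x). conf_residual lam J u B t x)"
proof -
  obtain u' where u': "\<And>z. z \<in> J \<times> UNIV \<Longrightarrow> ((\<lambda>(t, x). u t x) has_derivative u' z) (at z within J \<times> UNIV)"
    and cu': "\<And>v. continuous_on (J \<times> UNIV) (\<lambda>z. u' z v)"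
    and cu: "continuous_on (J \<times> UNIV) (\<lambda>z. u (fst z) (snd z))"
    by (rule smooth_fieldE[OF u]) (rule that)
  obtain B' where B': "\<And>z. z \<in> J \<times> UNIV \<Longrightarrow> ((\<lambda>(t, x). B t x) has_derivative B' z) (at z within J \<times> UNIV)"
    and cB': "\<And>v. continuous_on (J \<times> UNIV) (\<lambda>z. B' z v)"
    and cB: "continuous_on (J \<times> UNIV) (\<lambda>z. B (fst z) (snd z))"
    by (rule smooth_fieldE[OF B]) (rule that)
  (* A, A' and G are the conformation tensor, its space-time derivative and the velocity gradient,
     as functions of the space-time point. *)
  define A where "A z = mat_exp (B (fst z) (snd z))" for z
  define A' where "A' z v = dexp (B (fst z) (snd z)) (B' z v)" for z v
  define G where "G z = (\<chi> i j. u' z (0, axis j 1) $ i)" for z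
  have A': "((\<lambda>(t, x). mat_exp (B t x)) has_derivative A' z) (at z within J \<times> UNIV)"
    if "z \<in> J \<times> UNIV" for z
    using has_derivative_compose[OF B'[OF that] has_derivative_mat_exp]
    by (simp add: case_prod_beta' A'_def[abs_def])
  have G: "vgrad (u t) x = G (t, x)" if "t \<in> J" for t x
  proof -
    have "partial j (\<lambda>y. u t y $ i) x = u' (t, x) (0, axis j 1) $ i" for i j
    proof (rule partial_spacetime[OF _ that])
      show "((\<lambda>(t, y). u t y $ i) has_derivative (\<lambda>v. u' (t, x) v $ i)) (at (t, x) within J \<times> UNIV)"
        using bounded_linear.has_derivative[OF bounded_linear_vec_nth u'[of "(t, x)"]] that
        by (simp add: case_prod_beta')
    qed
    then show ?thesis by (simp add: vgrad_def G_def)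
  qed
  have eq: "conf_residual lam J u B t x =
      A' (t, x) (1, 0) + (\<Sum>k\<in>UNIV. u t x $ k *\<^sub>R A' (t, x) (0, axis k 1))
        - G (t, x) ** A (t, x) - A (t, x) ** transpose (G (t, x)) + (1 / lam) *\<^sub>R (A (t, x) - mat 1)"
    if t: "t \<in> J" for t x
  proof -
    note d = A'[of "(t, x)", simplified, OF t]
    have "time_deriv J (\<lambda>s y. mat_exp (B s y)) t x = A' (t, x) (1, 0)"
      by (rule time_deriv_spacetime[OF d t at_within_interval_neq_bot[OF J t]])
    moreover have "partial k (\<lambda>y. mat_exp (B t y)) x = A' (t, x) (0, axis k 1)" for k
      by (rule partial_spacetime[OF d t])
    ultimately show ?thesis
      by (simp add: conf_residual_def Let_def advect_def G[OF t] A_def)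
  qed
  have cA: "continuous_on (J \<times> UNIV) A"
    unfolding A_def by (rule continuous_on_compose2[OF continuous_mat_exp cB]) simp
  have cA': "continuous_on (J \<times> UNIV) (\<lambda>z. A' z v)" for v
    using continuous_on_compose2[OF continuous_dexp continuous_on_Pair[OF cB cB'[of v]]]
    by (simp add: A'_def)
  have cG: "continuous_on (J \<times> UNIV) G" "continuous_on (J \<times> UNIV) (\<lambda>z. transpose (G z))"
    unfolding G_def transpose_def by (auto intro!: continuous_intros cu' continuous_on_vec_lambda)
  have "continuous_on (J \<times> UNIV) (\<lambda>z. A' z (1, 0)
      + (\<Sum>k\<in>UNIV. u (fst z) (snd z) $ k *\<^sub>R A' z (0, axis k 1))
      - G z ** A z - A z ** transpose (G z) + (1 / lam) *\<^sub>R (A z - mat 1))"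
    by (intro continuous_intros cA cA' cG cu matmul.continuous_on)
  then show ?thesis
    by (rule continuous_on_cong[THEN iffD1, rotated 2]) (auto simp: eq)
qed

section \<open>The bound on a single time slice\<close>

text \<open>
If \<open>f\<close> is integrable, the integral of the sum splits, and the integral of \<open>f\<close> is at most the
absolute value of the integral of \<open>g\<close>.  If not, the Bochner integral of \<open>f\<close> is zero by convention and
the bound is trivial.  For \<open>f\<close> the density of the residual work, this case distinction replaces a
regularity theory of the anti-divergence.
\<close>

lemma set_integral_positive_part_le:
  fixes f g :: "'a \<Rightarrow> real"
  assumes g: "set_integrable M S g" and le: "(LINT x:S|M. f x + g x) \<le> 0"
  shows "ennreal (max (LINT x:S|M. f x) 0) \<le> (\<integral>\<^sup>+x\<in>S. ennreal \<bar>g x\<bar> \<partial>M)"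
proof (cases "set_integrable M S f")
  case True
  have "max (LINT x:S|M. f x) 0 \<le> norm (LINT x:S|M. g x)"
    using le set_integral_add(2)[OF True g] by simp
  also have "ennreal (norm (LINT x:S|M. g x)) \<le> (\<integral>\<^sup>+x. norm (indicator S x *\<^sub>R g x) \<partial>M)"
    using g unfolding set_integrable_def set_lebesgue_integral_def
    by (rule integral_norm_bound_ennreal)
  also have "\<dots> = (\<integral>\<^sup>+x\<in>S. ennreal \<bar>g x\<bar> \<partial>M)"
    by (intro nn_integral_cong) (auto split: split_indicator)
  finally show ?thesis by (simp add: ennreal_leI)
next
  case False
  then have "(LINT x:S|M. f x) = 0"
    unfolding set_integrable_def set_lebesgue_integral_def by (rule not_integrable_integral_eq)
  then show ?thesis by simp
qed

text \<open>
On one time slice, admissibility forces positive residual work to be paid for by the entropy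
production.  Its density is at most \<open>\<alpha>/2 |I - exp (- B)| |S|\<close>, and \<open>|I - exp (- B)| \<le> \<epsilon> e\<close> for
\<open>|B| \<le> \<epsilon> \<le> 1\<close>.
\<close>

lemma residual_work_slice_bound:
  assumes \<alpha>: "\<alpha> > 0" and \<epsilon>: "0 \<le> \<epsilon>" "\<epsilon> \<le> 1"
    and S: "continuous_on UNIV S" and B: "continuous_on UNIV B"
    and small: "AE x in lborel. x \<in> torus_cell \<longrightarrow> norm (B x) \<le> \<epsilon>"
    and le: "(LINT x:torus_cell|lebesgue. f x + \<alpha> / 2 * frob (mat 1 - matrix_inv (mat_exp (B x))) (S x)) \<le> 0"
  shows "ennreal (max (LINT x:torus_cell|lebesgue. f x) 0)
           \<le> ennreal (\<alpha> / 2 * (\<epsilon> * exp 1)) * (\<integral>\<^sup>+x\<in>torus_cell. ennreal (norm (S x)) \<partial>lborel)"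
proof -
  define g where "g x = \<alpha> / 2 * frob (mat 1 - matrix_inv (mat_exp (B x))) (S x)" for x
  have "continuous_on UNIV (\<lambda>x. mat_exp (- B x))"
    by (rule continuous_on_compose2[OF continuous_mat_exp]) (auto intro!: continuous_intros B)
  then have "continuous_on torus_cell g"
    unfolding g_def frob_eq_inner matrix_inv_mat_exp
    by (intro continuous_on_subset[of UNIV _ torus_cell] continuous_intros S) auto
  then have "set_integrable lebesgue torus_cell g"
    unfolding set_integrable_def
    by (intro integrable_completion[THEN iffD2] borel_integrable_compact borel_measurable_integrable)
       (auto simp: torus_cell_def)
  from set_integral_positive_part_le[OF this le[folded g_def]]
  have "ennreal (max (LINT x:torus_cell|lebesgue. f x) 0) \<le> (\<integral>\<^sup>+x\<in>torus_cell. ennreal \<bar>g x\<bar> \<partial>lborel)"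
    by (simp add: nn_integral_completion)
  also have "\<dots> \<le> (\<integral>\<^sup>+x. ennreal (\<alpha> / 2 * (\<epsilon> * exp 1)) * (ennreal (norm (S x)) * indicator torus_cell x) \<partial>lborel)"
  proof (rule nn_integral_mono_AE, use small in eventually_elim)
    case (elim x)
    show ?case
    proof (cases "x \<in> torus_cell")
      case True
      with elim have b: "norm (B x) \<le> \<epsilon>" by simp
      have "norm (mat 1 - mat_exp (- B x)) \<le> norm (B x) * exp (norm (B x))"
        using norm_mat_exp_diff[of "- B x"] by (simp add: norm_minus_commute)
      also have "\<dots> \<le> \<epsilon> * exp 1"
        using b \<epsilon> by (intro mult_mono) auto
      finally have "\<bar>g x\<bar> \<le> \<alpha> / 2 * ((\<epsilon> * exp 1) * norm (S x))"
        unfolding g_def frob_eq_inner matrix_inv_mat_exp abs_mult using \<alpha>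
        by (intro mult_mono order_trans[OF Cauchy_Schwarz_ineq2] mult_right_mono) auto
      then show ?thesis
        using True \<alpha> \<epsilon> by (simp add: ennreal_leI flip: ennreal_mult)
    qed simp
  qed
  also have "\<dots> = ennreal (\<alpha> / 2 * (\<epsilon> * exp 1)) * (\<integral>\<^sup>+x\<in>torus_cell. ennreal (norm (S x)) \<partial>lborel)"
    using borel_measurable_continuous_onI[OF S]
    by (intro nn_integral_cmult) (auto simp: torus_cell_def)
  finally show ?thesis .
qed

section \<open>Lebesgue measurable time windows\<close>

text \<open>
Fubini's theorem for null sets turns the essential bound on the space-time window into an essential
bound on almost every time slice.
\<close>

lemma AE_slice_norm_le:
  fixes f :: "real \<times> (real^3) \<Rightarrow> 'b::real_normed_vector"
  assumes "E \<times> C \<in> sets lebesgue" and "Linf_norm (E \<times> C) f \<le> ennreal \<epsilon>" and "0 \<le> \<epsilon>"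
  shows "AE t in lborel. t \<in> E \<longrightarrow> (AE x in lborel. x \<in> C \<longrightarrow> norm (f (t, x)) \<le> \<epsilon>)"
proof -
  have "AE z in lebesgue_on (E \<times> C). norm (f z) \<le> \<epsilon>"
    using esssup_AE[of "\<lambda>z. ennreal (norm (f z))" "lebesgue_on (E \<times> C)"]
  proof eventually_elim
    case (elim z)
    then have "ennreal (norm (f z)) \<le> ennreal \<epsilon>"
      using assms(2) unfolding Linf_norm_def by (rule order_trans)
    then show ?case using assms(3) by simp
  qed
  then have "AE z in lebesgue. z \<in> E \<times> C \<longrightarrow> norm (f z) \<le> \<epsilon>"
    using assms(1) by (subst (asm) AE_restrict_space_iff) (auto simp: )
  then have "AE z in lborel \<Otimes>\<^sub>M lborel. z \<in> E \<times> C \<longrightarrow> norm (f z) \<le> \<epsilon>"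
    unfolding AE_completion_iff lborel_prod .
  from lborel_pair.AE_pair[OF this] show ?thesis
    by eventually_elim auto
qed

text \<open>
A Lebesgue measurable window \<open>E\<close> agrees up to a null set with a Borel set \<open>E0\<close>.  The product
\<open>E0 \<times> torus_cell\<close> is Borel, so that Tonelli's theorem for the product of Borel measures applies.
\<close>

lemma lebesgue_times_cell:
  assumes "E \<in> sets lebesgue"
  obtains E0 where "E0 \<in> sets borel" "E0 \<subseteq> E" "AE t in lborel. t \<in> E \<longrightarrow> t \<in> E0"
    "E \<times> torus_cell \<in> sets lebesgue"
proof -
  obtain E0 N0 N' where E: "E = E0 \<union> N0" "N0 \<subseteq> N'" "N' \<in> null_sets lborel" "E0 \<in> sets lborel"
    using assms by (rule sets_completionE)
  have "N' \<times> torus_cell \<in> null_sets (lborel \<Otimes>\<^sub>M lborel)"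
    using E(3) by (auto simp: null_sets_def lborel.emeasure_pair_measure_Times torus_cell_def)
  then have N: "N' \<times> torus_cell \<in> null_sets lborel" unfolding lborel_prod .
  have "E0 \<times> torus_cell \<in> sets (lborel \<Otimes>\<^sub>M lborel)"
    using E(4) by (auto simp: torus_cell_def)
  then have C0: "E0 \<times> torus_cell \<in> sets lborel" unfolding lborel_prod .
  have "E \<times> torus_cell \<in> sets lebesgue"
    by (rule sets_completionI[OF _ _ N C0, of _ "N0 \<times> torus_cell"]) (use E in auto)
  moreover have "AE t in lborel. t \<in> E \<longrightarrow> t \<in> E0"
    using AE_not_in[OF E(3)] by eventually_elim (use E in auto)
  ultimately show ?thesis using that[of E0] E by auto
qed

section \<open>The lower bound on a time window\<close>

lemma ennreal_power2_le_imp_le: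
  fixes x y :: ennreal
  assumes "x\<^sup>2 \<le> y\<^sup>2" "y < \<infinity>"
  shows "x \<le> y"
proof (cases "y = 0")
  case True
  then show ?thesis using assms(1) by (simp add: power2_eq_square)
next
  case False
  show ?thesis
  proof (rule ccontr)
    assume "\<not> x \<le> y"
    then have "y < x" by simp
    then have "y * y < x * y"
      using assms(2) False by (intro ennreal_mult_strict_right_mono) (auto simp: zero_less_iff_neq_zero)
    also have "\<dots> \<le> x * x"
      using \<open>y < x\<close> by (intro mult_left_mono) auto
    finally show False using assms(1) by (simp add: power2_eq_square)
  qed
qed

text \<open>
The Cauchy--Schwarz inequality against the indicator function.  Continuity makes \<open>f\<close>
Borel measurable on the Borel set \<open>T\<close>; enlarging \<open>T\<close> to \<open>S\<close> only increases the integral and the measure.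
\<close>

lemma nn_integral_norm_le_L2:
  fixes f :: "'a::euclidean_space \<Rightarrow> 'b::{real_normed_vector,second_countable_topology}"
  assumes T: "T \<in> sets borel" "T \<subseteq> S" and S: "S \<in> sets lebesgue" "emeasure lebesgue S \<le> ennreal M"
    and f: "continuous_on T f" and M: "0 < M"
  shows "(\<integral>\<^sup>+z\<in>T. ennreal (norm (f z)) \<partial>lborel) \<le> ennreal (sqrt M) * L2_norm S f"
proof (cases "(\<integral>\<^sup>+z. ennreal ((norm (f z))\<^sup>2) \<partial>lebesgue_on S) = \<infinity>")
  case True
  then show ?thesis using M by (simp add: L2_norm_def ennreal_mult_top)
next
  case False
  then obtain r where r: "0 \<le> r" "(\<integral>\<^sup>+z. ennreal ((norm (f z))\<^sup>2) \<partial>lebesgue_on S) = ennreal r"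
    by (cases "(\<integral>\<^sup>+z. ennreal ((norm (f z))\<^sup>2) \<partial>lebesgue_on S)") auto
  have L2: "L2_norm S f = ennreal (sqrt r)" using r by (simp add: L2_norm_def)
  have fm: "(\<lambda>z. indicator T z *\<^sub>R f z) \<in> borel_measurable borel"
    by (rule borel_measurable_continuous_on_indicator[OF T(1) f])
  have "(\<lambda>z. ennreal (norm (indicator T z *\<^sub>R f z))) \<in> borel_measurable lborel"
    using fm by measurable
  also have "(\<lambda>z. ennreal (norm (indicator T z *\<^sub>R f z))) = (\<lambda>z. ennreal (norm (f z)) * indicator T z)"
    by (auto split: split_indicator)
  finally have m: "(\<lambda>z. ennreal (norm (f z)) * indicator T z) \<in> borel_measurable lborel" .
  have "(\<integral>\<^sup>+z\<in>T. ennreal (norm (f z)) \<partial>lborel)\<^sup>2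
      = (\<integral>\<^sup>+z. (ennreal (norm (f z)) * indicator T z) * indicator T z \<partial>lborel)\<^sup>2"
    by (intro arg_cong[where f = "\<lambda>a. a\<^sup>2"] nn_integral_cong) (auto split: split_indicator)
  also have "\<dots> \<le> (\<integral>\<^sup>+z. (ennreal (norm (f z)) * indicator T z)\<^sup>2 \<partial>lborel) * (\<integral>\<^sup>+z. (indicator T z)\<^sup>2 \<partial>lborel)"
    by (rule Cauchy_Schwarz_nn_integral[OF m]) (use T in auto)
  also have "\<dots> \<le> ennreal r * ennreal M"
  proof (rule mult_mono)
    have "(\<integral>\<^sup>+z. (ennreal (norm (f z)) * indicator T z)\<^sup>2 \<partial>lborel)
        \<le> (\<integral>\<^sup>+z. ennreal ((norm (f z))\<^sup>2) * indicator S z \<partial>lborel)"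
      using T(2) by (intro nn_integral_mono) (auto split: split_indicator simp: ennreal_power)
    also have "\<dots> = ennreal r"
      using r(2) S(1) by (simp add: nn_integral_restrict_space nn_integral_completion)
    finally show "(\<integral>\<^sup>+z. (ennreal (norm (f z)) * indicator T z)\<^sup>2 \<partial>lborel) \<le> ennreal r" .
    have "(\<integral>\<^sup>+z. (indicator T z :: ennreal)\<^sup>2 \<partial>lborel) = (\<integral>\<^sup>+z. indicator T z \<partial>lborel)"
      by (intro nn_integral_cong) (auto split: split_indicator)
    also have "\<dots> = emeasure lebesgue T" using T by simp
    also have "\<dots> \<le> emeasure lebesgue S" by (rule emeasure_mono[OF T(2) S(1)])
    finally show "(\<integral>\<^sup>+z. (indicator T z :: ennreal)\<^sup>2 \<partial>lborel) \<le> ennreal M"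
      using S(2) by simp
  qed auto
  also have "\<dots> = (ennreal (sqrt M) * ennreal (sqrt r))\<^sup>2"
    using M r by (simp add: ennreal_power mult.commute flip: ennreal_mult real_sqrt_mult)
  finally have "(\<integral>\<^sup>+z\<in>T. ennreal (norm (f z)) \<partial>lborel) \<le> ennreal (sqrt M) * ennreal (sqrt r)"
    by (rule ennreal_power2_le_imp_le) (simp add: ennreal_mult_less_top)
  then show ?thesis by (simp add: L2)
qed

text \<open>
Integrating the slice bound over the window gives \<open>W \<le> \<alpha>/2 \<epsilon> e \<parallel>S\<parallel>\<^sub>1\<close> by Tonelli's theorem, and
\<open>\<parallel>S\<parallel>\<^sub>1 \<le> \<surd>M \<parallel>S\<parallel>\<^sub>2\<close> by Cauchy--Schwarz.
\<close>

lemma residual_L2_lower_bound: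
  assumes pos: "\<alpha> > 0" "M > 0" "0 < \<epsilon>" "\<epsilon> \<le> 1"
    and J: "is_interval J" "interior J \<noteq> {}"
    and u: "smooth_field J u" and B: "smooth_field J B"
    and E: "E \<in> sets lebesgue" "E \<subseteq> J" "emeasure lebesgue (E \<times> torus_cell) \<le> ennreal M"
    and small: "Linf_norm (E \<times> torus_cell) (\<lambda>(t, x). B t x) \<le> ennreal \<epsilon>"
    and work: "ennreal W \<le> (\<integral>\<^sup>+t\<in>E. ennreal (max (residual_work \<nu> \<alpha> J u B t) 0) \<partial>lebesgue)"
    and adm: "energy_entropy_admissible \<alpha> (residual_matching_state \<nu> \<alpha> lam J u p B)"
  shows "ennreal (2 * W / (\<alpha> * exp 1 * \<epsilon> * sqrt M))
           \<le> L2_norm (E \<times> torus_cell) (\<lambda>(t, x). conf_residual lam J u B t x)"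
proof -
  let ?S = "conf_residual lam J u B"
  define c where "c = \<alpha> / 2 * (\<epsilon> * exp 1)"
  have c: "c > 0" using pos by (simp add: c_def)
  obtain E0 where E0: "E0 \<in> sets borel" "E0 \<subseteq> E" "AE t in lborel. t \<in> E \<longrightarrow> t \<in> E0"
    and EC: "E \<times> torus_cell \<in> sets lebesgue"
    using lebesgue_times_cell[OF E(1)] by blast
  have T: "E0 \<times> torus_cell \<in> sets borel"
    using E0(1) by (intro borel_Times) (auto simp: torus_cell_def)
  have cS: "continuous_on (J \<times> UNIV) (\<lambda>(t, x). ?S t x)"
    by (rule continuous_on_conf_residual[OF J u B])
  have cB: "continuous_on (J \<times> UNIV) (\<lambda>(t, x). B t x)"
    by (rule smooth_fieldE[OF B]) (simp add: case_prod_beta')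
  have slice: "continuous_on UNIV (f t)" if "continuous_on (J \<times> UNIV) (\<lambda>(t, x). f t x)" "t \<in> J"
    for f :: "real \<Rightarrow> real^3 \<Rightarrow> real^3^3" and t
  proof -
    have "continuous_on UNIV (Pair t :: real^3 \<Rightarrow> real \<times> (real^3))"
      by (intro continuous_intros)
    then show ?thesis
      using continuous_on_compose2[OF that(1), of UNIV "Pair t"] that(2) by auto
  qed
  define g where "g z = ennreal (norm (case z of (t, x) \<Rightarrow> ?S t x)) * indicator (E0 \<times> torus_cell) z" for z
  have gm: "g \<in> borel_measurable (lborel \<Otimes>\<^sub>M lborel)"
  proof -
    have "(\<lambda>z. indicator (E0 \<times> torus_cell) z *\<^sub>R (case z of (t, x) \<Rightarrow> ?S t x)) \<in> borel_measurable borel"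
      by (rule borel_measurable_continuous_on_indicator[OF T continuous_on_subset[OF cS]])
         (use E0 E in auto)
    then have "(\<lambda>z. ennreal (norm (indicator (E0 \<times> torus_cell) z *\<^sub>R (case z of (t, x) \<Rightarrow> ?S t x)))) \<in> borel_measurable borel"
      by measurable
    also have "(\<lambda>z. ennreal (norm (indicator (E0 \<times> torus_cell) z *\<^sub>R (case z of (t, x) \<Rightarrow> ?S t x)))) = g"
      by (auto simp: g_def split: split_indicator)
    finally show ?thesis unfolding lborel_prod by simp
  qed
  have "AE t in lborel. t \<in> J \<longrightarrow>
        (LINT x:torus_cell|lebesgue.
           - frob (antidiv (mom_residual \<nu> \<alpha> J u B t) x) (sym_grad (u t) x)
           + \<alpha> / 2 * frob (mat 1 - matrix_inv (mat_exp (B t x))) (?S t x)) \<le> 0"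
    using adm by (simp add: energy_entropy_admissible_def residual_matching_state_def AE_completion_iff)
  with E0(3) AE_slice_norm_le[OF EC small less_imp_le[OF pos(3)]]
  have "AE t in lborel. ennreal (max (residual_work \<nu> \<alpha> J u B t) 0) * indicator E t
          \<le> ennreal c * (\<integral>\<^sup>+x. g (t, x) \<partial>lborel)"
  proof eventually_elim
    case (elim t)
    show ?case
    proof (cases "t \<in> E")
      case True
      then have t: "t \<in> J" "t \<in> E0" using E elim by auto
      have "ennreal (max (residual_work \<nu> \<alpha> J u B t) 0)
          \<le> ennreal c * (\<integral>\<^sup>+x\<in>torus_cell. ennreal (norm (?S t x)) \<partial>lborel)"
        unfolding residual_work_def c_def
        by (rule residual_work_slice_bound[OF _ _ _ slice[OF cS t(1)] slice[OF cB t(1)]])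
           (use elim t True pos in auto)
      also have "(\<integral>\<^sup>+x\<in>torus_cell. ennreal (norm (?S t x)) \<partial>lborel) = (\<integral>\<^sup>+x. g (t, x) \<partial>lborel)"
        using t by (intro nn_integral_cong) (auto simp: g_def split: split_indicator)
      finally show ?thesis using True by simp
    qed simp
  qed
  then have "(\<integral>\<^sup>+t\<in>E. ennreal (max (residual_work \<nu> \<alpha> J u B t) 0) \<partial>lborel)
      \<le> (\<integral>\<^sup>+t. ennreal c * (\<integral>\<^sup>+x. g (t, x) \<partial>lborel) \<partial>lborel)"
    by (rule nn_integral_mono_AE)
  also have "\<dots> = ennreal c * (\<integral>\<^sup>+t. (\<integral>\<^sup>+x. g (t, x) \<partial>lborel) \<partial>lborel)"
    using lborel.borel_measurable_nn_integral_fst[OF gm] by (rule nn_integral_cmult)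
  also have "(\<integral>\<^sup>+t. (\<integral>\<^sup>+x. g (t, x) \<partial>lborel) \<partial>lborel) = (\<integral>\<^sup>+z. g z \<partial>lborel)"
    unfolding lborel.nn_integral_fst[OF gm] lborel_prod ..
  finally have W: "ennreal W \<le> ennreal c * (\<integral>\<^sup>+z. g z \<partial>lborel)"
    using work by (simp add: nn_integral_completion)
  have le: "(\<integral>\<^sup>+z. g z \<partial>lborel)
      \<le> ennreal (sqrt M) * L2_norm (E \<times> torus_cell) (\<lambda>(t, x). ?S t x)"
    unfolding g_def
    by (rule nn_integral_norm_le_L2[OF T _ EC E(3) continuous_on_subset[OF cS]])
       (use E0 E pos in auto)
  show ?thesis
  proof (cases "L2_norm (E \<times> torus_cell) (\<lambda>(t, x). ?S t x)")
    case (real r)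
    have "ennreal W \<le> ennreal c * (ennreal (sqrt M) * ennreal r)"
      using W mult_left_mono[OF le, of "ennreal c"] real by (metis order_trans zero_le)
    also have "\<dots> = ennreal (c * (sqrt M * r))"
      using c pos real by (simp add: ennreal_mult)
    finally have "W \<le> c * (sqrt M * r)"
      using c pos real by (subst (asm) ennreal_le_iff) auto
    then have "2 * W / (\<alpha> * exp 1 * \<epsilon> * sqrt M) \<le> r"
      using pos by (simp add: c_def field_simps)
    then show ?thesis using real by (simp add: ennreal_leI)
  qed simp
qed

section \<open>Blow-up of the conformation residual\<close>

theorem corollary9p2:
  fixes \<nu> \<alpha> lam M W0 :: real
    and J E :: "nat \<Rightarrow> real set"
    and u :: "nat \<Rightarrow> real \<Rightarrow> real^3 \<Rightarrow> real^3"
    and p :: "nat \<Rightarrow> real \<Rightarrow> real^3 \<Rightarrow> real"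
    and B :: "nat \<Rightarrow> real \<Rightarrow> real^3 \<Rightarrow> real^3^3"
    and \<epsilon> :: "nat \<Rightarrow> real"
  assumes "\<nu> > 0" and "\<alpha> > 0" and "lam > 0" and "M > 0" and "W0 > 0"
    and "\<And>n. is_interval (J n)" and "\<And>n. interior (J n) \<noteq> {}"
    and "\<And>n. smooth_field (J n) (u n)"
    and "\<And>n. smooth_field (J n) (p n)"
    and "\<And>n. smooth_field (J n) (B n)"
    and "\<And>n t x. t \<in> J n \<Longrightarrow> vdiv (u n t) x = 0"
    and "\<And>n s t. s \<in> J n \<Longrightarrow> t \<in> J n \<Longrightarrow> spatial_mean (u n s) = spatial_mean (u n t)"
    and "\<And>n t x. t \<in> J n \<Longrightarrow> transpose (B n t x) = B n t x"
    and "\<And>n. E n \<in> sets lebesgue" and "\<And>n. E n \<subseteq> J n"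
    and "\<And>n. emeasure lebesgue (E n \<times> torus_cell) \<le> ennreal M"
    and "\<And>n. 0 < \<epsilon> n" and "\<And>n. \<epsilon> n \<le> 1" and "\<epsilon> \<longlonglongrightarrow> 0"
    and "\<And>n. Linf_norm (E n \<times> torus_cell) (\<lambda>(t, x). B n t x) \<le> ennreal (\<epsilon> n)"
    and "\<And>n. (\<integral>\<^sup>+t\<in>E n. ennreal (max (residual_work \<nu> \<alpha> (J n) (u n) (B n) t) 0) \<partial>lebesgue)
                \<ge> ennreal W0"
    and "\<And>n. energy_entropy_admissible \<alpha>
                (residual_matching_state \<nu> \<alpha> lam (J n) (u n) (p n) (B n))"
  shows "(\<forall>n. L2_norm (E n \<times> torus_cell) (\<lambda>(t, x). conf_residual lam (J n) (u n) (B n) t x)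
                \<ge> ennreal (2 * W0 / (\<alpha> * exp 1 * \<epsilon> n * M powr (1 / 2))))
         \<and> filterlim (\<lambda>n. 2 * W0 / (\<alpha> * exp 1 * \<epsilon> n * M powr (1 / 2))) at_top sequentially"
proof (intro conjI allI)
  fix n
  have "M powr (1 / 2) = sqrt M"
    using assms(4) by (simp add: powr_half_sqrt)
  then show "ennreal (2 * W0 / (\<alpha> * exp 1 * \<epsilon> n * M powr (1 / 2)))
      \<le> L2_norm (E n \<times> torus_cell) (\<lambda>(t, x). conf_residual lam (J n) (u n) (B n) t x)"
    using residual_L2_lower_bound[OF assms(2,4,17,18,6,7,8,10,14,15,16,20,21,22)] by simp
next
  have "filterlim (\<lambda>n. inverse (\<epsilon> n)) at_top sequentially"
    using assms(17,19) by (intro filterlim_inverse_at_top) auto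
  then have "filterlim (\<lambda>n. 2 * W0 / (\<alpha> * exp 1 * M powr (1 / 2)) * inverse (\<epsilon> n)) at_top sequentially"
    using assms(2,4,5) by (intro filterlim_tendsto_pos_mult_at_top[OF tendsto_const]) auto
  then show "filterlim (\<lambda>n. 2 * W0 / (\<alpha> * exp 1 * \<epsilon> n * M powr (1 / 2))) at_top sequentially"
    by (simp add: field_simps)
qed

end
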